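(* Let $G$ be a $P\mathcal{M}$-factorizable topological group and $H$ a compact metrizable topological group. Then the product group $G\times H$ is $P\mathcal{M}$-factorizable.
   Context: All topological spaces (in particular all topological groups) are assumed Hausdorff. A continuous map $f:X\to Y$ is perfect if it is closed, onto, and all fibers $f^{-1}(y)$ are compact; a perfect homomorphism is a continuous group homomorphism that is a perfect map. A topological group $G$ is $P\mathcal{M}$-factorizable if for every continuous function $f:G\to\mathbb{R}$ there are a perfect homomorphism $\pi:G\to H$ onto a metrizable topological group $H$ and a continuous function $g:H\to\mathbb{R}$ such that $f=g\circ\pi$. *)

theory Defs
  imports "HOL-Analysis.Analysis" "HOL-Algebra.Group"
begin

locale topological_group = group G for G (structure) +
  fixes T :: "'a topology"
  assumes topspace_eq: "topspace T = carrier G"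
    and Hausdorff: "Hausdorff_space T"
    and continuous_mult: "continuous_map (prod_topology T T) T (\<lambda>(x, y). x \<otimes> y)"
    and continuous_inv: "continuous_map T T (\<lambda>x. inv x)"

definition perfect_hom ::
  "('a, 'm) monoid_scheme \<Rightarrow> 'a topology \<Rightarrow> ('b, 'n) monoid_scheme \<Rightarrow> 'b topology \<Rightarrow> ('a \<Rightarrow> 'b) \<Rightarrow> bool"
  where "perfect_hom G T K S \<pi> \<longleftrightarrow> \<pi> \<in> hom G K \<and> perfect_map T S \<pi>"

text \<open>HOL cannot quantify over all types inside a formula, so the metrizable group \<open>K\<close> is taken
  with elements of type \<^typ>\<open>'a set\<close>, the type of the cosets of a kernel in \<open>G\<close>. Nothing is lost,
  since \<open>K\<close> is an image of \<open>G\<close>: see \<open>perfect_factorization_any_type\<close> below.\<close>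

definition PM_factorizable :: "('a, 'm) monoid_scheme \<Rightarrow> 'a topology \<Rightarrow> bool"
  where "PM_factorizable G T \<longleftrightarrow>
    topological_group G T \<and>
    (\<forall>f. continuous_map T euclideanreal f \<longrightarrow>
      (\<exists>(K :: 'a set monoid) S \<pi> g.
        topological_group K S \<and> metrizable_space S \<and>
        perfect_hom G T K S \<pi> \<and>
        continuous_map S euclideanreal g \<and>
        (\<forall>x\<in>carrier G. f x = g (\<pi> x))))"

lemma perfect_factorization_any_type:
  fixes G :: "('a, 'm) monoid_scheme" and K :: "('c, 'n) monoid_scheme" and f :: "'a \<Rightarrow> real"
  assumes G: "topological_group G T"
    and K: "topological_group K S" "metrizable_space S"
    and \<pi>: "perfect_hom G T K S \<pi>"
    and g: "continuous_map S euclideanreal g" "\<forall>x\<in>carrier G. f x = g (\<pi> x)"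
  shows "\<exists>(K' :: 'a set monoid) S' \<pi>' g'.
        topological_group K' S' \<and> metrizable_space S' \<and>
        perfect_hom G T K' S' \<pi>' \<and>
        continuous_map S' euclideanreal g' \<and>
        (\<forall>x\<in>carrier G. f x = g' (\<pi>' x))"
proof -
  interpret G: topological_group G T by fact
  interpret K: topological_group K S by fact
  have hom: "\<pi> \<in> hom G K" and perf: "perfect_map T S \<pi>"
    using \<pi> by (auto simp: perfect_hom_def)
  have onto: "\<pi> ` carrier G = carrier K"
    using perf by (simp add: perfect_map_def G.topspace_eq K.topspace_eq)
  define e where "e y = {x \<in> carrier G. \<pi> x = y}" for y
  define C where "C = e ` carrier K"
  define r where "r = inv_into (carrier K) e"
  have inj: "inj_on e (carrier K)"
  proof (rule inj_onI)
    fix y z assume y: "y \<in> carrier K" and "e y = e z"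
    obtain x where "x \<in> e y" using y[folded onto] by (auto simp: e_def)
    moreover then have "x \<in> e z" using \<open>e y = e z\<close> by simp
    ultimately show "y = z" by (simp add: e_def)
  qed
  have re: "r (e y) = y" if "y \<in> carrier K" for y
    using inj that by (simp add: r_def)
  have er: "e (r A) = A" if "A \<in> C" for A
    using that by (auto simp: C_def re)
  have rC: "r A \<in> carrier K" if "A \<in> C" for A
    using that by (auto simp: C_def re)
  have eC: "e y \<in> C" if "y \<in> carrier K" for y
    using that by (simp add: C_def)
  define K' where "K' = \<lparr>carrier = C, mult = (\<lambda>A B. e (r A \<otimes>\<^bsub>K\<^esub> r B)), one = e \<one>\<^bsub>K\<^esub>\<rparr>"
  define S' where "S' = pullback_topology C r S"
  have sel: "carrier K' = C" "\<And>A B. A \<otimes>\<^bsub>K'\<^esub> B = e (r A \<otimes>\<^bsub>K\<^esub> r B)" "\<one>\<^bsub>K'\<^esub> = e \<one>\<^bsub>K\<^esub>"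
    by (simp_all add: K'_def)
  have grp: "group K'"
  proof (rule groupI)
    fix A assume "A \<in> carrier K'"
    then show "\<exists>B\<in>carrier K'. B \<otimes>\<^bsub>K'\<^esub> A = \<one>\<^bsub>K'\<^esub>"
      by (intro bexI[of _ "e (inv\<^bsub>K\<^esub> r A)"]) (simp_all add: sel eC re rC)
  qed (simp_all add: sel eC re rC er K.m_assoc)
  interpret K': group K' by fact
  have inv': "inv\<^bsub>K'\<^esub> A = e (inv\<^bsub>K\<^esub> r A)" if "A \<in> C" for A
    using that by (intro K'.inv_equality) (simp_all add: sel eC re rC)
  have top': "topspace S' = C"
    using rC by (auto simp: S'_def topspace_pullback_topology K.topspace_eq)
  have cr: "continuous_map S' S r"
    unfolding S'_def by (metis continuous_map_id continuous_map_pullback comp_id id_comp)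
  have ce: "continuous_map S S' e"
    unfolding S'_def
  proof (rule continuous_map_pullback')
    show "continuous_map S S (r \<circ> e)"
      by (rule continuous_map_eq[OF continuous_map_id]) (simp add: re K.topspace_eq)
    show "topspace S \<subseteq> e -` C" using eC by (auto simp: K.topspace_eq)
  qed
  have hm: "homeomorphic_maps S S' e r"
    unfolding homeomorphic_maps_def using cr ce by (simp add: re er top' K.topspace_eq)
  then have hs: "S homeomorphic_space S'"
    unfolding homeomorphic_space_def by blast
  have met: "metrizable_space S'"
    using homeomorphic_metrizable_space[OF hs] K(2) by simp
  have tg: "topological_group K' S'"
  proof
    show "topspace S' = carrier K'" by (simp add: top' sel)
    show "Hausdorff_space S'" using met by (rule metrizable_imp_Hausdorff_space)
    have "continuous_map (prod_topology S' S') (prod_topology S S) (\<lambda>p. (r (fst p), r (snd p)))"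
      by (intro continuous_map_pairedI continuous_map_compose[OF continuous_map_fst cr, unfolded comp_def]
          continuous_map_compose[OF continuous_map_snd cr, unfolded comp_def])
    from continuous_map_compose[OF continuous_map_compose[OF this K.continuous_mult] ce]
    show "continuous_map (prod_topology S' S') S' (\<lambda>(x, y). x \<otimes>\<^bsub>K'\<^esub> y)"
      by (simp add: sel comp_def case_prod_unfold)
    from continuous_map_compose[OF continuous_map_compose[OF cr K.continuous_inv] ce]
    show "continuous_map S' S' (\<lambda>x. inv\<^bsub>K'\<^esub> x)"
      by (rule continuous_map_eq) (simp add: inv' top')
  qed
  have piK: "\<pi> x \<in> carrier K" if "x \<in> carrier G" for x
    using that onto by blast
  have "perfect_map S S' e"
    using hm homeomorphic_imp_perfect_map homeomorphic_map_maps by blast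
  then have "perfect_map T S' (e \<circ> \<pi>)"
    using perf perfect_map_compose by blast
  moreover have "e \<circ> \<pi> \<in> hom G K'"
    using hom by (auto simp: hom_def sel re eC piK)
  ultimately have "perfect_hom G T K' S' (e \<circ> \<pi>)"
    by (simp add: perfect_hom_def)
  moreover have "continuous_map S' euclideanreal (g \<circ> r)"
    using continuous_map_compose[OF cr g(1)] .
  moreover have "\<forall>x\<in>carrier G. f x = (g \<circ> r) ((e \<circ> \<pi>) x)"
    using g(2) by (simp add: re piK)
  ultimately show ?thesis using tg met by blast
qed

end

theory Submission
  imports Defs "HOL-Algebra.Product_Groups"
begin

text \<open>Choose a countable dense subset \<open>D\<close> of \<open>H\<close> and factorize each slice \<open>x \<mapsto> f (x, d)\<close> with
  \<open>d \<in> D\<close> through a perfect homomorphism \<open>\<pi>\<^sub>d\<close> onto a metrizable group. The diagonal homomorphism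
  \<open>\<pi>\<close> of the \<open>\<pi>\<^sub>d\<close> is perfect onto its image, because its composition with a projection is.
  All slices \<open>f (\<cdot>, d)\<close> with \<open>d \<in> D\<close> are constant on the fibres of \<open>\<pi>\<close>, hence so is every
  slice by density, and \<open>f\<close> descends along the perfect (so quotient) map \<open>\<pi> \<times> id\<close>.\<close>

lemma topological_group_DirProd:
  assumes "topological_group G T" "topological_group H S"
  shows "topological_group (G \<times>\<times> H) (prod_topology T S)"
proof -
  interpret G: topological_group G T by fact
  interpret H: topological_group H S by fact
  interpret GH: group "G \<times>\<times> H" by (rule DirProd_group) unfold_locales
  let ?P = "prod_topology T S"
  show ?thesis
  proof
    show "topspace ?P = carrier (G \<times>\<times> H)"
      by (simp add: G.topspace_eq H.topspace_eq)
    show "Hausdorff_space ?P"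
      by (simp add: Hausdorff_space_prod_topology G.Hausdorff H.Hausdorff)
    \<comment> \<open>Multiplication acts in each factor separately, so the four coordinates are
      regrouped by factor and the two multiplications are then composed with these
      regroupings.\<close>
    have p1: "continuous_map (prod_topology ?P ?P) (prod_topology T T) (\<lambda>p. (fst (fst p), fst (snd p)))"
      and p2: "continuous_map (prod_topology ?P ?P) (prod_topology S S) (\<lambda>p. (snd (fst p), snd (snd p)))"
      by (rule continuous_map_pairedI[OF
            continuous_map_compose[OF continuous_map_fst continuous_map_fst, unfolded comp_def]
            continuous_map_compose[OF continuous_map_snd continuous_map_fst, unfolded comp_def]],
          rule continuous_map_pairedI[OF
            continuous_map_compose[OF continuous_map_fst continuous_map_snd, unfolded comp_def]
            continuous_map_compose[OF continuous_map_snd continuous_map_snd, unfolded comp_def]])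
    show "continuous_map (prod_topology ?P ?P) ?P (\<lambda>(x, y). x \<otimes>\<^bsub>G \<times>\<times> H\<^esub> y)"
      using continuous_map_compose[OF p1 G.continuous_mult] continuous_map_compose[OF p2 H.continuous_mult]
      by (simp add: case_prod_unfold mult_DirProd' continuous_map_paired comp_def)
    have "continuous_map ?P ?P (\<lambda>p. (inv\<^bsub>G\<^esub> (fst p), inv\<^bsub>H\<^esub> (snd p)))"
      by (rule continuous_map_pairedI[OF
            continuous_map_compose[OF continuous_map_fst G.continuous_inv, unfolded comp_def]
            continuous_map_compose[OF continuous_map_snd H.continuous_inv, unfolded comp_def]])
    then show "continuous_map ?P ?P (\<lambda>x. inv\<^bsub>G \<times>\<times> H\<^esub> x)"
      by (rule continuous_map_eq)
        (auto simp: G.topspace_eq H.topspace_eq inv_DirProd G.group_axioms H.group_axioms)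
  qed
qed

text \<open>This is the ambient group of the diagonal homomorphism. Continuity into a product
  topology is tested coordinatewise, where it reduces to continuity in a single factor.\<close>

lemma topological_group_product_group:
  assumes "\<And>i. i \<in> I \<Longrightarrow> topological_group (G i) (T i)"
  shows "topological_group (product_group I G) (product_topology T I)"
proof -
  have grp: "group (G i)" if "i \<in> I" for i
    using assms[OF that] by (simp add: topological_group_def)
  note ax = topological_group.topspace_eq[OF assms] topological_group.Hausdorff[OF assms]
  interpret P: group "product_group I G" using grp by simp
  let ?P = "product_topology T I"
  show ?thesis
  proof
    show top: "topspace ?P = carrier (product_group I G)"
      by (auto simp: ax cong: PiE_cong)
    show "Hausdorff_space ?P"
      by (simp add: Hausdorff_space_product_topology ax)
    have "continuous_map (prod_topology ?P ?P) (T i) (\<lambda>p. fst p i \<otimes>\<^bsub>G i\<^esub> snd p i)" if i: "i \<in> I" for i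
    proof -
      have pr: "continuous_map ?P (T i) (\<lambda>x. x i)"
        using i by (rule continuous_map_product_projection)
      have "continuous_map (prod_topology ?P ?P) (prod_topology (T i) (T i)) (\<lambda>p. (fst p i, snd p i))"
        by (intro continuous_map_pairedI continuous_map_compose[OF continuous_map_fst pr, unfolded comp_def]
            continuous_map_compose[OF continuous_map_snd pr, unfolded comp_def])
      from continuous_map_compose[OF this topological_group.continuous_mult[OF assms[OF i]]]
      show ?thesis by (simp add: comp_def)
    qed
    then show "continuous_map (prod_topology ?P ?P) ?P (\<lambda>(x, y). x \<otimes>\<^bsub>product_group I G\<^esub> y)"
      by (auto simp: continuous_map_componentwise case_prod_unfold)
    have "continuous_map ?P (T i) (\<lambda>x. inv\<^bsub>G i\<^esub> x i)" if i: "i \<in> I" for i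
      using continuous_map_compose[OF continuous_map_product_projection[OF i, of T]
          topological_group.continuous_inv[OF assms[OF i]]]
      by (simp add: comp_def)
    \<comment> \<open>Points of the product are extensional functions, hence the restriction to
      \<open>I\<close>. The formula for the inverse holds on the carrier only, so continuity is
      proved for the explicit map and transferred along equality on the topspace.\<close>
    then have "continuous_map ?P ?P (\<lambda>x. \<lambda>i\<in>I. inv\<^bsub>G i\<^esub> x i)"
      by (auto simp: continuous_map_componentwise)
    then show "continuous_map ?P ?P (\<lambda>x. inv\<^bsub>product_group I G\<^esub> x)"
      by (rule continuous_map_eq) (use top grp in \<open>simp add: inv_product_group\<close>)
  qed
qed

lemma (in topological_group) topological_group_subgroup:
  assumes "subgroup H G"
  shows "topological_group (G\<lparr>carrier := H\<rparr>) (subtopology T H)"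
proof -
  interpret H: group "G\<lparr>carrier := H\<rparr>" using subgroup_imp_group[OF assms] .
  have sub: "H \<subseteq> topspace T" using subgroup.subset[OF assms] by (simp add: topspace_eq)
  show ?thesis
  proof
    show top: "topspace (subtopology T H) = carrier (G\<lparr>carrier := H\<rparr>)"
      using sub by auto
    show "Hausdorff_space (subtopology T H)"
      by (simp add: Hausdorff Hausdorff_space_subtopology)
    have "continuous_map (prod_topology (subtopology T H) (subtopology T H)) T (\<lambda>(x, y). x \<otimes> y)"
      \<comment> \<open>A product of subspaces is a subspace of the product, so the multiplication
        of \<open>G\<close> is merely restricted.\<close>
      unfolding subtopology_Times[symmetric] prod_topology_subtopology
      by (simp add: continuous_mult continuous_map_from_subtopology)
    then show "continuous_map (prod_topology (subtopology T H) (subtopology T H)) (subtopology T H)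
        (\<lambda>(x, y). x \<otimes>\<^bsub>G\<lparr>carrier := H\<rparr>\<^esub> y)"
      by (auto simp: continuous_map_in_subtopology subgroup.m_closed[OF assms])
    have "continuous_map (subtopology T H) (subtopology T H) (\<lambda>x. inv x)"
      by (auto simp: continuous_map_in_subtopology continuous_map_from_subtopology continuous_inv
          subgroup.m_inv_closed[OF assms])
    then show "continuous_map (subtopology T H) (subtopology T H) (\<lambda>x. inv\<^bsub>G\<lparr>carrier := H\<rparr>\<^esub> x)"
      by (rule continuous_map_eq) (simp add: m_inv_consistent[OF assms])
  qed
qed

text \<open>Compactness gives total boundedness: for each \<open>n\<close> there is a finite net of
  radius \<open>inverse (Suc n)\<close>. The union of these nets is countable and dense.\<close>

lemma compact_metrizable_imp_separable_space:
  assumes "compact_space X" "metrizable_space X"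
  shows "separable_space X"
proof -
  obtain M d where M: "Metric_space M d" and X: "X = Metric_space.mtopology M d"
    using assms(2) by (auto simp: metrizable_space_def)
  interpret Metric_space M d by fact
  have "mtotally_bounded M"
    using assms(1) by (metis X compact_space_def compactin_imp_mtotally_bounded topspace_mtopology)
  \<comment> \<open>With \<open>Suc n\<close> the radius is positive for \<open>n = 0\<close> as
    well.\<close>
  then have "\<exists>K. finite K \<and> K \<subseteq> M \<and> M \<subseteq> (\<Union>x\<in>K. mball x (inverse (Suc n)))" for n
    unfolding mtotally_bounded_def by simp
  then obtain K where K: "\<And>n. finite (K n)" "\<And>n. K n \<subseteq> M"
      "\<And>n. M \<subseteq> (\<Union>x\<in>K n. mball x (inverse (Suc n)))"
    by metis
  have "mtopology closure_of (\<Union>n. K n) = M"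
  proof (intro equalityI subsetI)
    fix x assume x: "x \<in> M"
    show "x \<in> mtopology closure_of (\<Union>n. K n)"
      unfolding metric_closure_of
    proof (intro CollectI conjI allI impI)
      fix r :: real assume "0 < r"
      then obtain n where n: "inverse (Suc n) < r" using reals_Archimedean by blast
      obtain y where "y \<in> K n" "x \<in> mball y (inverse (Suc n))" using K(3) x by blast
      then show "\<exists>y\<in>\<Union>n. K n. y \<in> mball x r"
        using n by (auto simp: commute intro!: exI[of _ n] bexI[of _ y])
    qed (use x in simp)
  qed (simp add: metric_closure_of)
  then show ?thesis
    unfolding separable_space_def X using K by (intro exI[of _ "\<Union>n. K n"]) (auto simp: countable_finite)
qed

text \<open>Countability of \<open>I\<close> makes the product, and hence the image
  \<open>L\<close>, metrizable. Properness comes from a single coordinate, so \<open>I\<close> has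
  to be nonempty. Taking the image as the target makes \<open>q\<close> onto.\<close>

lemma perfect_hom_diagonal:
  assumes G: "topological_group G T"
    and I: "countable I" "I \<noteq> {}"
    and K: "\<And>i. i \<in> I \<Longrightarrow> topological_group (K i) (S i)" "\<And>i. i \<in> I \<Longrightarrow> metrizable_space (S i)"
    and p: "\<And>i. i \<in> I \<Longrightarrow> perfect_hom G T (K i) (S i) (p i)"
  defines "q \<equiv> \<lambda>x. \<lambda>i\<in>I. p i x"
  defines "L \<equiv> (product_group I K)\<lparr>carrier := q ` carrier G\<rparr>"
    and "U \<equiv> subtopology (product_topology S I) (q ` carrier G)"
  shows "topological_group L U" "metrizable_space U" "perfect_hom G T L U q"
proof -
  interpret G: topological_group G T by fact
  interpret P: topological_group "product_group I K" "product_topology S I"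
    using K(1) by (rule topological_group_product_group)
  have hom: "p i \<in> hom G (K i)" and perf: "perfect_map T (S i) (p i)" if "i \<in> I" for i
    using p[OF that] by (auto simp: perfect_hom_def)
  have q: "q \<in> hom G (product_group I K)"
    unfolding q_def by (rule homI) (auto simp: hom_mult[OF hom] hom_in_carrier[OF hom])
  then interpret q: group_hom G "product_group I K" q
    by unfold_locales
  show "topological_group L U"
    unfolding L_def U_def by (rule P.topological_group_subgroup[OF q.img_is_subgroup])
  show "metrizable_space U"
    \<comment> \<open>The metrizability criterion for products asks that at most countably many
      factors have more than one point; their indices form a subset of \<open>I\<close>.\<close>
    unfolding U_def using I K(2)
    by (intro metrizable_space_subtopology)
      (auto simp: metrizable_space_product_topology intro: countable_subset[OF _ I(1)])
  have cont: "continuous_map T (product_topology S I) q"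
    unfolding q_def using perf by (auto simp: continuous_map_componentwise perfect_map_def)
  \<comment> \<open>Projecting \<open>q\<close> to coordinate \<open>j\<close> gives back the proper
    map \<open>p j\<close>. When a composition of continuous maps is proper and the middle space is
    Hausdorff, the inner map is proper.\<close>
  obtain j where j: "j \<in> I" using I(2) by blast
  have "(\<lambda>y. y j) \<circ> q = p j" using j by (auto simp: q_def)
  then have "proper_map T (S j) ((\<lambda>y. y j) \<circ> q)"
    using perf[OF j] by (simp add: perfect_map_def)
  then have "proper_map T (product_topology S I) q"
    using proper_map_from_composition_right[OF P.Hausdorff _ cont continuous_map_product_projection[OF j]]
    by blast
  then have "proper_map T U q"
    unfolding U_def by (rule proper_map_into_subtopology) (auto simp: G.topspace_eq)
  moreover have "continuous_map T U q"
    unfolding U_def using cont by (simp add: continuous_map_in_subtopology G.topspace_eq)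
  moreover have "q ` topspace T = topspace U"
    unfolding U_def using continuous_map_image_subset_topspace[OF cont] by (auto simp: G.topspace_eq)
  ultimately have "perfect_map T U q"
    by (simp add: perfect_map_def)
  moreover have "q \<in> hom G L"
    using q by (auto simp: L_def hom_def)
  ultimately show "perfect_hom G T L U q"
    by (simp add: perfect_hom_def)
qed

text \<open>The identity is proper and products of proper maps are proper. Thus the second factor
  can be carried along unchanged.\<close>

lemma perfect_hom_DirProd_id:
  assumes "perfect_hom G T K S p"
  shows "perfect_hom (G \<times>\<times> H) (prod_topology T U) (K \<times>\<times> H) (prod_topology S U) (\<lambda>(x, y). (p x, y))"
proof -
  have "p \<in> hom G K" "continuous_map T S p" "proper_map T S p" "p ` topspace T = topspace S"
    using assms by (auto simp: perfect_hom_def perfect_map_def)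
  moreover have "(\<lambda>(x, y). (p x, y)) ` (topspace T \<times> topspace U) = (p ` topspace T) \<times> topspace U"
    by force
  ultimately show ?thesis
    by (auto simp: perfect_hom_def perfect_map_def proper_map_prod[of _ _ _ _ _ "\<lambda>y. y"]
        continuous_map_prod_top[of _ _ _ _ _ "\<lambda>y. y"] hom_def proper_map_id[unfolded id_def])
qed

theorem corollary4p13:
  fixes G :: "('a, 'm) monoid_scheme" and T :: "'a topology"
    and H :: "('b, 'n) monoid_scheme" and S :: "'b topology"
  assumes "PM_factorizable G T"
    and "topological_group H S" "compact_space S" "metrizable_space S"
  shows "PM_factorizable (G \<times>\<times> H) (prod_topology T S)"
proof -
  have G: "topological_group G T" using assms(1) by (simp add: PM_factorizable_def)
  interpret G: topological_group G T by fact
  interpret H: topological_group H S by fact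
  have GH: "topological_group (G \<times>\<times> H) (prod_topology T S)"
    using G assms(2) by (rule topological_group_DirProd)
  obtain D where D: "countable D" "D \<subseteq> carrier H" "S closure_of D = carrier H"
    using compact_metrizable_imp_separable_space[OF assms(3,4)]
    by (auto simp: separable_space_def H.topspace_eq)
  \<comment> \<open>The closure of \<open>D\<close> contains the identity of \<open>H\<close>.
    Nonemptiness supplies the coordinate that makes the diagonal proper.\<close>
  have "D \<noteq> {}" using D(3) H.one_closed by auto
  show ?thesis
    unfolding PM_factorizable_def
  proof (intro conjI GH allI impI)
    fix f :: "'a \<times> 'b \<Rightarrow> real"
    assume f: "continuous_map (prod_topology T S) euclideanreal f"
    have slice: "continuous_map T euclideanreal (\<lambda>x. f (x, d))" if "d \<in> carrier H" for d
    proof -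
      have "continuous_map T (prod_topology T S) (\<lambda>x. (x, d))"
        using that by (simp add: continuous_map_paired H.topspace_eq)
      from continuous_map_compose[OF this f] show ?thesis by (simp add: comp_def)
    qed
    \<comment> \<open>Each slice over \<open>D\<close> is determined by its own \<open>p d\<close>;
      choice then turns these factorizations into families indexed by \<open>D\<close>.\<close>
    have "\<forall>d\<in>D. \<exists>(K :: 'a set monoid) V p g. topological_group K V \<and> metrizable_space V \<and>
        perfect_hom G T K V p \<and> (\<forall>x\<in>carrier G. f (x, d) = g (p x))"
      using assms(1) slice D(2) unfolding PM_factorizable_def by blast
    then obtain K :: "'b \<Rightarrow> 'a set monoid" and V p and g :: "'b \<Rightarrow> 'a set \<Rightarrow> real"
      where K: "\<And>d. d \<in> D \<Longrightarrow> topological_group (K d) (V d)" "\<And>d. d \<in> D \<Longrightarrow> metrizable_space (V d)"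
        "\<And>d. d \<in> D \<Longrightarrow> perfect_hom G T (K d) (V d) (p d)"
        and g: "\<And>d x. d \<in> D \<Longrightarrow> x \<in> carrier G \<Longrightarrow> f (x, d) = g d (p d x)"
      by metis
    define q where "q = (\<lambda>x. \<lambda>d\<in>D. p d x)"
    define L where "L = (product_group D K)\<lparr>carrier := q ` carrier G\<rparr>"
    define U where "U = subtopology (product_topology V D) (q ` carrier G)"
    have L: "topological_group L U" "metrizable_space U" "perfect_hom G T L U q"
      unfolding L_def U_def q_def
      using perfect_hom_diagonal[of G T D K V p] G D(1) \<open>D \<noteq> {}\<close> K by simp_all
    let ?r = "\<lambda>(x, y). (q x, y)"
    have r: "perfect_hom (G \<times>\<times> H) (prod_topology T S) (L \<times>\<times> H) (prod_topology U S) ?r"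
      using L(3) by (rule perfect_hom_DirProd_id)
    \<comment> \<open>For fixed \<open>x\<close> and \<open>y\<close> both sides are continuous in
      \<open>h\<close>. They agree for \<open>h\<close> in \<open>D\<close>, since
      \<open>q x = q y\<close> read at coordinate \<open>d\<close> gives
      \<open>p d x = p d y\<close>, and so they agree on the closure of \<open>D\<close>.\<close>
    have fibre: "f (x, h) = f (y, h)"
      if xy: "x \<in> carrier G" "y \<in> carrier G" "q x = q y" and h: "h \<in> carrier H" for x y h
    proof (rule forall_in_closure_of_eq[where f = "\<lambda>h. f (x, h)" and g = "\<lambda>h. f (y, h)"])
      show "h \<in> S closure_of D" using h D(3) by simp
      show "Hausdorff_space euclideanreal" by simp
      have "continuous_map S euclideanreal (\<lambda>h. f (z, h))" if "z \<in> carrier G" for z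
      proof -
        have "continuous_map S (prod_topology T S) (\<lambda>h. (z, h))"
          using that by (simp add: continuous_map_paired G.topspace_eq)
        from continuous_map_compose[OF this f] show ?thesis by (simp add: comp_def)
      qed
      then show "continuous_map S euclideanreal (\<lambda>h. f (x, h))" "continuous_map S euclideanreal (\<lambda>h. f (y, h))"
        using xy by auto
      fix d assume d: "d \<in> D"
      then have "p d x = p d y" using fun_cong[OF xy(3), of d] by (simp add: q_def)
      then show "f (x, d) = f (y, d)" using g d xy by simp
    qed
    \<comment> \<open>A perfect map is a closed continuous surjection, hence a quotient map; this is
      what makes the function induced by \<open>f\<close> continuous.\<close>
    have quot: "quotient_map (prod_topology T S) (prod_topology U S) ?r"
      using r by (auto simp: perfect_hom_def intro: perfect_imp_quotient_map)
    \<comment> \<open>Two points in one fibre of \<open>?r\<close> share their second coordinate and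
      have first coordinates with equal \<open>q\<close>, so \<open>fibre\<close> applies.\<close>
    have const: "f z = f w" if "z \<in> topspace (prod_topology T S)" "w \<in> topspace (prod_topology T S)" "?r z = ?r w" for z w
      using that by (auto simp: G.topspace_eq H.topspace_eq intro: fibre)
    obtain k where k: "continuous_map (prod_topology U S) euclideanreal k"
        "\<And>z. z \<in> topspace (prod_topology T S) \<Longrightarrow> k (?r z) = f z"
      by (rule quotient_map_lift_exists[OF quot f const]) (assumption+, rule that, assumption, simp only:)
    show "\<exists>(K :: ('a \<times> 'b) set monoid) V \<pi> g. topological_group K V \<and> metrizable_space V \<and>
        perfect_hom (G \<times>\<times> H) (prod_topology T S) K V \<pi> \<and> continuous_map V euclideanreal g \<and>
        (\<forall>x\<in>carrier (G \<times>\<times> H). f x = g (\<pi> x))"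
    \<comment> \<open>The elements of \<open>L \<times>\<times> H\<close> are pairs in
      \<open>('b \<Rightarrow> 'a set) \<times> 'b\<close>, whereas the definition asks for a group
      on \<open>('a \<times> 'b) set\<close>; the factorization is transported to that type.\<close>
    proof (rule perfect_factorization_any_type[OF GH _ _ r k(1)])
      show "topological_group (L \<times>\<times> H) (prod_topology U S)"
        using L(1) assms(2) by (rule topological_group_DirProd)
      show "metrizable_space (prod_topology U S)"
        by (simp add: metrizable_space_prod_topology L(2) assms(4))
      show "\<forall>z\<in>carrier (G \<times>\<times> H). f z = k (?r z)"
        using k(2) by (auto simp: G.topspace_eq H.topspace_eq)
    qed
  qed
qed

end
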